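(* Let $n\ge 1$, let $X$ be the number of lucky cars of a uniformly random parking function of $1,\ldots,n$, and let \[ f(x)=\frac1{n+1}\prod_{i=1}^n\big((n+2-i)x+(i-1)\big). \] Then for every integer $\ell\ge 1$, \[ E\big(X(X-1)\cdots(X-(\ell-1))\big)=\frac{1}{(n+1)^{n-1}}f^{(\ell)}(1), \] where $f^{(\ell)}$ denotes the $\ell$-th derivative of $f$.
   Context: There are $n$ spots labeled $1,\ldots,n$ in order along a one-way street, and $n$ cars entering one after another, car $i$ having preference $a_i\in\{1,\ldots,n\}$. Each car drives to its preferred spot and parks there if it is available; otherwise it moves forward and parks in the first available later spot, if any (if none, it fails to park). A parking function of $1,\ldots,n$ is a sequence of preferences $(a_1,\ldots,a_n)$ such that all $n$ cars are able to park. A car is lucky if it parks in its preferred spot. The random parking function is chosen uniformly from all parking functions of $1,\ldots,n$, and $E$ denotes expectation. *)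

theory Defs
  imports "HOL-Probability.Probability"
begin

(* The first free spot in {a..n}: this is a itself whenever a is free, and otherwise the
   first available later spot. None means that the car fails to park. *)
definition park_spot :: "nat \<Rightarrow> nat set \<Rightarrow> nat \<Rightarrow> nat option" where
  "park_spot n occupied a =
     (let free = {a..n} - occupied in if free = {} then None else Some (Min free))"

(* Entry i (counted from 0) of the result is the spot taken by the (i+1)-st car of the list. *)
fun park_cars :: "nat \<Rightarrow> nat set \<Rightarrow> nat list \<Rightarrow> nat option list" where
  "park_cars n occupied [] = []"
| "park_cars n occupied (a # as) =
     (let s = park_spot n occupied a in s # park_cars n (occupied \<union> set_option s) as)"

definition parking_functions :: "nat \<Rightarrow> nat list set" where
  "parking_functions n =
     {as. length as = n \<and> set as \<subseteq> {1..n} \<and> None \<notin> set (park_cars n {} as)}"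

definition lucky_cars :: "nat \<Rightarrow> nat list \<Rightarrow> nat" where
  "lucky_cars n as = card {i. i < length as \<and> park_cars n {} as ! i = Some (as ! i)}"

definition lucky_fun :: "nat \<Rightarrow> real \<Rightarrow> real" where
  "lucky_fun n x =
     1 / (real n + 1) * (\<Prod>i=1..n. ((real n + 2 - real i) * x + (real i - 1)))"

end

(* Pollak's circle argument. Add an extra spot 0 and close the street up into a circle of
   N = n + 1 spots, so that every preference list in {0..n} lets all n cars park and leaves exactly
   one spot empty; it is a parking function iff that spot is 0. Rotating the preferences rotates the
   outcome and keeps lucky cars lucky, so each spot is left empty with the same generating
   polynomial of lucky cars. On the circle, a car that finds j spots occupied has N - j lucky and
   j unlucky preferences whatever happened before, so the generating polynomial of all preference
   lists is a product; f is 1 / (n + 1) times it, and the factorial moments are derivatives at 1. *)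
theory Submission
  imports Defs
begin

section \<open>Parking on a circle of \<open>N\<close> spots\<close>

definition circ_spot :: "nat \<Rightarrow> nat set \<Rightarrow> nat \<Rightarrow> nat" where
  "circ_spot N occ a = (a + (LEAST k. (a + k) mod N \<notin> occ)) mod N"

fun circ_park :: "nat \<Rightarrow> nat set \<Rightarrow> nat list \<Rightarrow> nat list" where
  "circ_park N occ [] = []"
| "circ_park N occ (a # as) =
     (let s = circ_spot N occ a in s # circ_park N (insert s occ) as)"

definition circ_lucky :: "nat \<Rightarrow> nat set \<Rightarrow> nat list \<Rightarrow> nat" where
  "circ_lucky N occ as = card {i. i < length as \<and> circ_park N occ as ! i = as ! i}"

definition prefs :: "nat \<Rightarrow> nat \<Rightarrow> nat list set" where
  "prefs N k = {as. length as = k \<and> set as \<subseteq> {..<N}}"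

definition rot :: "nat \<Rightarrow> nat \<Rightarrow> nat" where
  "rot N x = Suc x mod N"

lemma finite_prefs [simp]: "finite (prefs N k)"
  using finite_lists_length_eq[of "{..<N}" k] by (simp add: prefs_def conj_commute)

lemma prefs_0: "prefs N 0 = {[]}"
  by (auto simp: prefs_def)

lemma prefs_Suc: "prefs N (Suc k) = (\<lambda>(a, as). a # as) ` ({..<N} \<times> prefs N k)"
  by (force simp: prefs_def length_Suc_conv image_iff)

lemma sum_prefs_Suc:
  "(\<Sum>as\<in>prefs N (Suc k). g as) = (\<Sum>a<N. \<Sum>as\<in>prefs N k. g (a # as))"
proof -
  have "inj_on (\<lambda>(a, as). a # as) ({..<N} \<times> prefs N k)"
    by (auto simp: inj_on_def)
  then show ?thesis
    by (simp add: prefs_Suc sum.reindex sum.cartesian_product case_prod_unfold)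
qed

lemma length_circ_park [simp]: "length (circ_park N occ as) = length as"
  by (induction as arbitrary: occ) (auto simp: Let_def)

lemma circ_spot_free:
  assumes "a < N" "c < N" "c \<notin> occ"
  shows "circ_spot N occ a \<notin> occ"
proof -
  \<comment> \<open>The offset \<open>N + c - a\<close> leads from \<open>a\<close> to the free spot
    \<open>c\<close>, so the \<open>LEAST\<close> in \<open>circ_spot\<close> is attained; on a full
    circle it would be unspecified.\<close>
  have "(a + (N + c - a)) mod N \<notin> occ"
    using assms by simp
  then show ?thesis
    unfolding circ_spot_def by (rule LeastI)
qed

lemma circ_spot_less: "a < N \<Longrightarrow> circ_spot N occ a < N"
  by (simp add: circ_spot_def)

lemma circ_spot_eq_iff:
  assumes "a < N" "c < N" "c \<notin> occ"
  shows "circ_spot N occ a = a \<longleftrightarrow> a \<notin> occ"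
proof
  assume "circ_spot N occ a = a"
  then show "a \<notin> occ" using circ_spot_free[OF assms] by simp
next
  assume "a \<notin> occ"
  then have "(LEAST k. (a + k) mod N \<notin> occ) = 0"
    using assms by (intro Least_eq_0) simp
  then show "circ_spot N occ a = a"
    using assms by (simp add: circ_spot_def)
qed

lemma circ_spot_eqI:
  assumes "(a + k) mod N \<notin> occ" "\<And>j. j < k \<Longrightarrow> (a + j) mod N \<in> occ"
  shows "circ_spot N occ a = (a + k) mod N"
proof -
  have "(LEAST k. (a + k) mod N \<notin> occ) = k"
    using assms by (intro Least_equality) (auto simp: not_less[symmetric])
  then show ?thesis by (simp add: circ_spot_def)
qed

lemma free_spot_exists:
  assumes "occ \<subseteq> {..<N}" "card occ < N"
  obtains c where "c < N" "c \<notin> occ"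
proof -
  have "\<not> {..<N} \<subseteq> occ"
    using assms card_mono[of occ "{..<N}"] finite_subset[OF assms(1)] by auto
  then show ?thesis using that by auto
qed

text \<open>As long as the circle is not full, each car finds a free spot and adds exactly one new
  element to the occupied set.\<close>

lemma circ_park_occupied:
  assumes "occ \<subseteq> {..<N}" "card occ + length as \<le> N" "set as \<subseteq> {..<N}"
  shows "occ \<union> set (circ_park N occ as) \<subseteq> {..<N}
    \<and> card (occ \<union> set (circ_park N occ as)) = card occ + length as"
  using assms
proof (induction as arbitrary: occ)
  case (Cons a as)
  obtain c where c: "c < N" "c \<notin> occ"
    using Cons.prems free_spot_exists[of occ N] by auto
  define s where "s = circ_spot N occ a"
  have s: "s < N" "s \<notin> occ"
    using Cons.prems c circ_spot_less[of a N occ] circ_spot_free[of a N c occ]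
    by (auto simp: s_def)
  have "finite occ" using Cons.prems finite_subset by blast
  then have "card (insert s occ) = Suc (card occ)" using s by simp
  then show ?case
    using Cons.IH[of "insert s occ"] Cons.prems s by (simp add: Let_def flip: s_def)
qed simp

section \<open>The generating polynomial of lucky cars over all circular preference lists\<close>

lemma power_card_eq_prod:
  fixes x :: "'a :: comm_semiring_1" and k :: nat
  shows "x ^ card {i. i < k \<and> P i} = (\<Prod>i<k. if P i then x else 1)"
proof -
  have "{i. i < k \<and> P i} = {..<k} \<inter> {i. P i}" by auto
  then show ?thesis by (simp add: prod.If_cases)
qed

text \<open>Writing the power as a product over the cars allows the factor of the first car to be
  split off.\<close>

lemma power_circ_lucky_Cons:
  fixes x :: "'a :: comm_semiring_1"
  shows "x ^ circ_lucky N occ (a # as) = (if circ_spot N occ a = a then x else 1)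
    * x ^ circ_lucky N (insert (circ_spot N occ a) occ) as"
  unfolding circ_lucky_def power_card_eq_prod
  by (simp add: prod.lessThan_Suc_shift Let_def del: prod.lessThan_Suc)

lemma sum_prefs_lucky:
  fixes x :: real
  assumes "occ \<subseteq> {..<N}" "card occ + k \<le> N"
  shows "(\<Sum>as\<in>prefs N k. x ^ circ_lucky N occ as)
    = (\<Prod>i<k. (real N - real (card occ + i)) * x + real (card occ + i))"
  using assms
proof (induction k arbitrary: occ)
  case 0
  then show ?case by (simp add: prefs_0 circ_lucky_def)
next
  case (Suc k)
  define m where "m = card occ"
  define P where "P = (\<Prod>i<k. (real N - real (Suc m + i)) * x + real (Suc m + i))"
  obtain c where c: "c < N" "c \<notin> occ"
    using Suc.prems free_spot_exists[of occ N] by auto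
  have fin: "finite occ" using Suc.prems finite_subset by blast
  \<comment> \<open>The induction hypothesis depends on the occupied set only through its size, so
    the remaining cars contribute the same \<open>P\<close> wherever the first car parks.\<close>
  have step: "(\<Sum>as\<in>prefs N k. x ^ circ_lucky N occ (a # as)) = (if a \<notin> occ then x else 1) * P"
    if "a < N" for a
  proof -
    define s where "s = circ_spot N occ a"
    have s: "s < N" "s \<notin> occ"
      using that c circ_spot_less[of a N occ] circ_spot_free[of a N c occ]
      by (auto simp: s_def)
    have "card (insert s occ) = Suc m" using s fin by (simp add: m_def)
    then have "(\<Sum>as\<in>prefs N k. x ^ circ_lucky N (insert s occ) as) = P"
      using Suc.IH[of "insert s occ"] Suc.prems s by (simp add: P_def m_def)
    then show ?thesis
      using circ_spot_eq_iff[OF that c]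
      by (simp add: power_circ_lucky_Cons flip: sum_distrib_left s_def)
  qed
  have "(\<Sum>a<N. if a \<notin> occ then x else 1) = real (card ({..<N} - occ)) * x + real (card occ)"
    using Suc.prems by (simp add: sum.If_cases Int_absorb1 Diff_eq Compl_eq)
  also have "real (card ({..<N} - occ)) = real N - real m"
    using Suc.prems fin by (simp add: card_Diff_subset m_def of_nat_diff)
  finally have "(\<Sum>a<N. if a \<notin> occ then x else 1) = (real N - real m) * x + real m"
    by (simp add: m_def)
  then have "(\<Sum>as\<in>prefs N (Suc k). x ^ circ_lucky N occ as) = ((real N - real m) * x + real m) * P"
    by (simp add: sum_prefs_Suc step flip: sum_distrib_right)
  then show ?case
    by (simp add: P_def m_def prod.lessThan_Suc_shift add.left_commute del: prod.lessThan_Suc)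
qed

section \<open>Rotational symmetry of the circle\<close>

lemma bij_betw_rot: "bij_betw (rot N) {..<N} {..<N}"
proof -
  have "inj_on (rot N) {..<N}"
    by (auto simp: inj_on_def rot_def mod_Suc split: if_splits)
  moreover have "rot N ` {..<N} \<subseteq> {..<N}"
    by (auto simp: rot_def)
  ultimately show ?thesis
    by (simp add: bij_betw_def endo_inj_surj)
qed

lemma rot_in_image_iff: "occ \<subseteq> {..<N} \<Longrightarrow> a < N \<Longrightarrow> rot N a \<in> rot N ` occ \<longleftrightarrow> a \<in> occ"
  using inj_on_image_mem_iff[OF bij_betw_imp_inj_on[OF bij_betw_rot]] by simp

text \<open>Rotation commutes with moving forward modulo \<open>N\<close>, so the same offsets are
  free before and after it and the least one is unchanged.\<close>

lemma circ_spot_rot: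
  assumes "occ \<subseteq> {..<N}" "a < N"
  shows "circ_spot N (rot N ` occ) (rot N a) = rot N (circ_spot N occ a)"
proof -
  have shift: "(rot N a + k) mod N = rot N ((a + k) mod N)" for k
    by (simp add: rot_def mod_simps)
  have "(rot N a + k) mod N \<in> rot N ` occ \<longleftrightarrow> (a + k) mod N \<in> occ" for k
    using assms by (simp add: shift rot_in_image_iff)
  then show ?thesis
    by (simp add: circ_spot_def shift)
qed

lemma circ_park_rot:
  assumes "occ \<subseteq> {..<N}" "set as \<subseteq> {..<N}"
  shows "circ_park N (rot N ` occ) (map (rot N) as) = map (rot N) (circ_park N occ as)"
  using assms
proof (induction as arbitrary: occ)
  case (Cons a as)
  then show ?case
    using Cons.IH[of "insert (circ_spot N occ a) occ"]
    by (simp add: Let_def circ_spot_rot circ_spot_less)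
qed simp

lemma set_circ_park:
  assumes "set as \<subseteq> {..<N}"
  shows "set (circ_park N occ as) \<subseteq> {..<N}"
  using assms by (induction as arbitrary: occ) (auto simp: Let_def circ_spot_less)

lemma circ_lucky_rot:
  assumes "set as \<subseteq> {..<N}"
  shows "circ_lucky N {} (map (rot N) as) = circ_lucky N {} as"
proof -
  have "rot N (circ_park N {} as ! i) = rot N (as ! i) \<longleftrightarrow> circ_park N {} as ! i = as ! i"
    if "i < length as" for i
  proof (rule inj_on_eq_iff[OF bij_betw_imp_inj_on[OF bij_betw_rot]])
    show "as ! i \<in> {..<N}" using assms that nth_mem by blast
    show "circ_park N {} as ! i \<in> {..<N}"
      using set_circ_park[OF assms, of "{}"] that nth_mem[of i "circ_park N {} as"]
      by (simp add: subset_iff)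
  qed
  then show ?thesis
    using circ_park_rot[of "{}" N as] assms
    unfolding circ_lucky_def by (intro arg_cong[where f = card]) auto
qed

lemma bij_betw_map_rot: "bij_betw (map (rot N)) (prefs N k) (prefs N k)"
proof -
  have inj: "inj_on (rot N) {..<N}"
    by (rule bij_betw_imp_inj_on[OF bij_betw_rot])
  have "inj_on (map (rot N)) (prefs N k)"
    by (rule inj_onI, erule map_inj_on, rule inj_on_subset[OF inj]) (auto simp: prefs_def)
  moreover have "map (rot N) ` prefs N k \<subseteq> prefs N k"
    using bij_betwE[OF bij_betw_rot, of N] by (force simp: prefs_def)
  ultimately show ?thesis
    by (simp add: bij_betw_def endo_inj_surj)
qed

text \<open>Reindexing by the bijection \<open>map (rot N)\<close> carries an empty spot
  \<open>c\<close> to \<open>rot N c\<close> and preserves the lucky count; the bound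
  \<open>Suc c < N\<close> excludes wrapping around, so \<open>rot N c\<close> is
  \<open>Suc c\<close>.\<close>

lemma sum_prefs_empty_spot_Suc:
  fixes x :: real
  assumes "Suc c < N"
  shows "(\<Sum>as\<in>{as\<in>prefs N k. Suc c \<notin> set (circ_park N {} as)}. x ^ circ_lucky N {} as)
    = (\<Sum>as\<in>{as\<in>prefs N k. c \<notin> set (circ_park N {} as)}. x ^ circ_lucky N {} as)"
proof -
  have *: "Suc c \<in> set (circ_park N {} (map (rot N) as)) \<longleftrightarrow> c \<in> set (circ_park N {} as)"
    if "as \<in> prefs N k" for as
    using that assms circ_park_rot[of "{}" N as]
      rot_in_image_iff[of "set (circ_park N {} as)" N c] set_circ_park[of as N "{}"]
    by (simp add: prefs_def rot_def[of N c])
  have "(\<Sum>as\<in>prefs N k. if Suc c \<notin> set (circ_park N {} as) then x ^ circ_lucky N {} as else 0)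
    = (\<Sum>as\<in>prefs N k. if c \<notin> set (circ_park N {} as) then x ^ circ_lucky N {} as else 0)"
    by (subst sum.reindex_bij_betw[OF bij_betw_map_rot, symmetric], rule sum.cong)
       (auto simp: * circ_lucky_rot prefs_def)
  then show ?thesis
    by (simp add: sum.inter_filter)
qed

lemma sum_prefs_empty_spot:
  fixes x :: real
  assumes "c < N"
  shows "(\<Sum>as\<in>{as\<in>prefs N k. c \<notin> set (circ_park N {} as)}. x ^ circ_lucky N {} as)
    = (\<Sum>as\<in>{as\<in>prefs N k. 0 \<notin> set (circ_park N {} as)}. x ^ circ_lucky N {} as)"
  using assms by (induction c) (simp_all add: sum_prefs_empty_spot_Suc)

text \<open>Double counting: classify the lists by their unique empty spot. The \<open>Suc n\<close>
  classes have equal sums by rotation.\<close>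

lemma sum_prefs_empty_spot_0:
  fixes x :: real
  shows "real (Suc n) *
      (\<Sum>as\<in>{as\<in>prefs (Suc n) n. 0 \<notin> set (circ_park (Suc n) {} as)}. x ^ circ_lucky (Suc n) {} as)
    = (\<Sum>as\<in>prefs (Suc n) n. x ^ circ_lucky (Suc n) {} as)" (is "_ * ?S = _")
proof -
  let ?N = "Suc n"
  have one: "card ({..<?N} - set (circ_park ?N {} as)) = 1" if "as \<in> prefs ?N n" for as
    using circ_park_occupied[of "{}" ?N as] that by (simp add: prefs_def card_Diff_subset)
  have "(\<Sum>as\<in>prefs ?N n. x ^ circ_lucky ?N {} as)
    = (\<Sum>as\<in>prefs ?N n. \<Sum>c<?N. if c \<notin> set (circ_park ?N {} as) then x ^ circ_lucky ?N {} as else 0)"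
  proof (rule sum.cong)
    fix as assume "as \<in> prefs ?N n"
    have "(\<Sum>c<?N. if c \<notin> set (circ_park ?N {} as) then x ^ circ_lucky ?N {} as else 0)
      = (\<Sum>c\<in>{..<?N} - set (circ_park ?N {} as). x ^ circ_lucky ?N {} as)"
      by (subst sum.inter_filter[symmetric]) (auto simp: set_diff_eq)
    also have "\<dots> = x ^ circ_lucky ?N {} as"
      using one[OF \<open>as \<in> prefs ?N n\<close>] by simp
    finally show "x ^ circ_lucky ?N {} as
      = (\<Sum>c<?N. if c \<notin> set (circ_park ?N {} as) then x ^ circ_lucky ?N {} as else 0)" ..
  qed simp
  also have "\<dots> = (\<Sum>c<?N. \<Sum>as\<in>{as\<in>prefs ?N n. c \<notin> set (circ_park ?N {} as)}. x ^ circ_lucky ?N {} as)"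
    by (subst sum.swap) (simp only: sum.inter_filter[OF finite_prefs])
  also have "\<dots> = (\<Sum>c<?N. ?S)"
    by (intro sum.cong sum_prefs_empty_spot) auto
  finally show ?thesis by simp
qed

section \<open>Comparing the street with the circle\<close>

lemma park_spot_eq_circ_spot:
  assumes "occ \<subseteq> {1..n}" "a \<in> {1..n}"
  shows "park_spot n occ a =
    (if circ_spot (Suc n) occ a = 0 then None else Some (circ_spot (Suc n) occ a))"
proof (cases "{a..n} - occ = {}")
  case True
  \<comment> \<open>When \<open>{a..n}\<close> is full, the next spot on the circle is 0, which is
    free because \<open>occ\<close> lies in \<open>{1..n}\<close>. Thus failing on the street means
    landing on 0.\<close>
  have "circ_spot (Suc n) occ a = (a + (Suc n - a)) mod Suc n"
    using assms True by (intro circ_spot_eqI) auto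
  then show ?thesis
    using assms True by (simp add: park_spot_def)
next
  case False
  define m where "m = Min ({a..n} - occ)"
  have m: "m \<in> {a..n} - occ"
    unfolding m_def using False by (intro Min_in) auto
  have below: "i \<in> occ" if "a \<le> i" "i < m" for i
    using Min_le[of "{a..n} - occ" i] that m by (force simp: m_def[symmetric])
  have "circ_spot (Suc n) occ a = (a + (m - a)) mod Suc n"
    using m below by (intro circ_spot_eqI) auto
  also have "\<dots> = m" using m by auto
  finally show ?thesis
    using False m assms by (simp add: park_spot_def m_def Let_def)
qed

text \<open>Once a car lands on 0 both sides are false. Until then the occupied set stays inside
  \<open>{1..n}\<close>, so the comparison for a single car applies to each car in turn.\<close>

lemma None_notin_park_cars_iff:
  assumes "occ \<subseteq> {1..n}" "set as \<subseteq> {1..n}"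
  shows "None \<notin> set (park_cars n occ as) \<longleftrightarrow> 0 \<notin> set (circ_park (Suc n) occ as)"
  using assms
proof (induction as arbitrary: occ)
  case (Cons a as)
  have "circ_spot (Suc n) occ a \<le> n"
    using Cons.prems circ_spot_less[of a "Suc n" occ] by auto
  then show ?case
    using Cons park_spot_eq_circ_spot[of occ n a] by (auto simp: Let_def)
qed simp

lemma park_cars_eq_circ_park:
  assumes "occ \<subseteq> {1..n}" "set as \<subseteq> {1..n}" "0 \<notin> set (circ_park (Suc n) occ as)"
  shows "park_cars n occ as = map Some (circ_park (Suc n) occ as)"
  using assms
proof (induction as arbitrary: occ)
  case (Cons a as)
  have "circ_spot (Suc n) occ a \<le> n"
    using Cons.prems circ_spot_less[of a "Suc n" occ] by auto
  then show ?case
    using Cons park_spot_eq_circ_spot[of occ n a] by (simp add: Let_def)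
qed simp

text \<open>A car preferring 0 either takes it or finds it taken. Hence a list that leaves 0 empty
  has all its preferences in \<open>{1..n}\<close> and is a legal list for the street.\<close>

lemma zero_parks:
  assumes "0 \<in> set as" "0 < N"
  shows "0 \<in> occ \<union> set (circ_park N occ as)"
  using assms
proof (induction as arbitrary: occ)
  case (Cons a as)
  show ?case
  proof (cases "a = 0")
    case True
    then show ?thesis
      using Cons.prems circ_spot_eq_iff[of 0 N 0 occ]
      by (cases "0 \<in> occ") (auto simp: Let_def)
  next
    case False
    then show ?thesis
      using Cons.IH[of "insert (circ_spot N occ a) occ"] Cons.prems by (auto simp: Let_def)
  qed
qed simp

lemma parking_functions_eq:
  "parking_functions n = {as\<in>prefs (Suc n) n. 0 \<notin> set (circ_park (Suc n) {} as)}"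
proof (intro set_eqI iffI)
  fix as assume "as \<in> parking_functions n"
  then show "as \<in> {as\<in>prefs (Suc n) n. 0 \<notin> set (circ_park (Suc n) {} as)}"
    using None_notin_park_cars_iff[of "{}" n as]
    by (auto simp: parking_functions_def prefs_def)
next
  fix as assume as: "as \<in> {as\<in>prefs (Suc n) n. 0 \<notin> set (circ_park (Suc n) {} as)}"
  then have "0 \<notin> set as" using zero_parks[of as "Suc n" "{}"] by auto
  then have "set as \<subseteq> {1..n}"
    using as by (force simp: prefs_def Suc_le_eq intro: gr0I)
  then show "as \<in> parking_functions n"
    using as None_notin_park_cars_iff[of "{}" n as]
    by (auto simp: parking_functions_def prefs_def)
qed

lemma lucky_cars_eq:
  assumes "as \<in> parking_functions n"
  shows "lucky_cars n as = circ_lucky (Suc n) {} as"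
proof -
  have "park_cars n {} as = map Some (circ_park (Suc n) {} as)"
    using assms park_cars_eq_circ_park[of "{}" n as] None_notin_park_cars_iff[of "{}" n as]
    by (simp add: parking_functions_def)
  then show ?thesis
    unfolding lucky_cars_def circ_lucky_def by (intro arg_cong[where f = card]) auto
qed

section \<open>The generating polynomial of parking functions and its derivatives\<close>

lemma lucky_generating_function:
  "(\<Sum>as\<in>parking_functions n. x ^ lucky_cars n as) = lucky_fun n x"
proof -
  have "real (Suc n) * (\<Sum>as\<in>parking_functions n. x ^ lucky_cars n as)
    = (\<Sum>as\<in>prefs (Suc n) n. x ^ circ_lucky (Suc n) {} as)"
    using sum_prefs_empty_spot_0[of n x]
    by (simp add: lucky_cars_eq cong: sum.cong flip: parking_functions_eq)
  also have "\<dots> = (\<Prod>i<n. (real (Suc n) - real i) * x + real i)"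
    using sum_prefs_lucky[of "{}" "Suc n" n x] by simp
  \<comment> \<open>Here \<open>i\<close> becomes the number of the car, which finds
    \<open>i - 1\<close> spots occupied.\<close>
  also have "\<dots> = (\<Prod>i=1..n. (real n + 2 - real i) * x + (real i - 1))"
    by (rule prod.reindex_bij_witness[of _ "\<lambda>i. i - 1" Suc]) (auto simp: of_nat_diff)
  finally show ?thesis
    by (simp add: lucky_fun_def field_simps)
qed

text \<open>At 1 the powers disappear and a sum of falling factorials of the \<open>m a\<close>
  remains, which is a factorial moment before normalization.\<close>

lemma higher_deriv_sum_powers:
  fixes m :: "'a \<Rightarrow> nat"
  shows "(deriv ^^ l) (\<lambda>x::real. \<Sum>a\<in>S. x ^ m a)
    = (\<lambda>x. \<Sum>a\<in>S. (\<Prod>j<l. real (m a) - real j) * x ^ (m a - l))"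
proof (induction l)
  case (Suc l)
  \<comment> \<open>For \<open>k < l\<close> the truncated difference \<open>k - l\<close> is 0, and
    both products vanish through their factor at \<open>j = k\<close>.\<close>
  have falling: "(\<Prod>j<l. real k - real j) * real (k - l) = (\<Prod>j<Suc l. real k - real j)" for k
    by (cases "l \<le> k") (auto simp: of_nat_diff intro!: prod_zero bexI[of _ k])
  have "deriv (\<lambda>x. \<Sum>a\<in>S. (\<Prod>j<l. real (m a) - real j) * x ^ (m a - l)) x
    = (\<Sum>a\<in>S. (\<Prod>j<Suc l. real (m a) - real j) * x ^ (m a - Suc l))" for x
    by (rule DERIV_imp_deriv)
       (auto intro!: derivative_eq_intros sum.cong simp: falling[symmetric] simp del: prod.lessThan_Suc)
  then show ?case
    by (simp add: Suc fun_eq_iff del: prod.lessThan_Suc)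
qed simp

text \<open>The cardinality is the generating polynomial at 1, where each of the \<open>n\<close>
  linear factors equals \<open>n + 1\<close>.\<close>

lemma card_parking_functions:
  assumes "n \<ge> 1"
  shows "real (card (parking_functions n)) = (real n + 1) ^ (n - 1)"
proof -
  have "real (card (parking_functions n)) = lucky_fun n 1"
    using lucky_generating_function[of 1 n] by simp
  also have "\<dots> = (real n + 1) ^ n / (real n + 1)"
    by (simp add: lucky_fun_def)
  also have "\<dots> = (real n + 1) ^ (n - 1)"
    using assms by (cases n) (simp_all add: field_simps)
  finally show ?thesis .
qed

theorem proposition2p1:
  fixes n l :: nat
  assumes "n \<ge> 1" and "l \<ge> 1"
  shows "measure_pmf.expectation (pmf_of_set (parking_functions n))
           (\<lambda>as. \<Prod>j<l. (real (lucky_cars n as) - real j))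
         = 1 / (real n + 1) ^ (n - 1) * (deriv ^^ l) (lucky_fun n) 1"
proof -
  have fin: "finite (parking_functions n)"
    by (simp add: parking_functions_eq)
  \<comment> \<open>The uniform distribution \<open>pmf_of_set\<close> is meaningful only on a
    nonempty finite set.\<close>
  have "card (parking_functions n) \<noteq> 0"
    using card_parking_functions[OF assms(1)] 
    by (metis Suc_not_Zero add.commute of_nat_0 of_nat_Suc of_nat_eq_0_iff power_not_zero)
  then have "parking_functions n \<noteq> {}" by auto
  moreover have "lucky_fun n = (\<lambda>x. \<Sum>as\<in>parking_functions n. x ^ lucky_cars n as)"
    by (simp add: lucky_generating_function)
  \<comment> \<open>The expectation is the sum of falling factorials divided by the cardinality, and
    that sum is the \<open>l\<close>-th derivative at 1.\<close>
  ultimately show ?thesis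
    using fin card_parking_functions[OF assms(1)]
    by (simp add: integral_pmf_of_set higher_deriv_sum_powers)
qed

end
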